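(* Let $(N,a)$ be one of the pairs $(26,13)$, $(28,-7)$, $(29,29)$, $(30,5)$, $(33,-11)$, $(35,5)$, $(39,13)$, $(40,-1)$, $(40,5)$, $(41,41)$, $(48,-1)$, $(48,3)$, $(50,5)$, and let $f_N$ be the polynomial listed in the context. Let $x_0\in\mathbb{Q}$ be such that $f_N(x_0)$ is not a square in $\mathbb{Q}$ and the point $(x_0,\sqrt{f_N(x_0)})$ on the model $y^2=f_N(x)$ of $X_0(N)$ is non-cuspidal, and let $K=\mathbb{Q}(\sqrt{f_N(x_0)})$. If a prime $p$ ramifies in $K$ (where for $(N,a)=(28,-7)$ one additionally assumes $p\neq 2$), then $a$ is a square modulo $p$.
   Context: For each $N$ the modular curve $X_0(N)$ is given by the hyperelliptic model $y^2=f_N(x)$ with: $f_{26}=x^6-8x^5+8x^4-18x^3+8x^2-8x+1$; $f_{28}=4x^6-12x^5+25x^4-30x^3+25x^2-12x+4$; $f_{29}=x^6-4x^5-12x^4+2x^3+8x^2+8x-7$; $f_{30}=x^8+14x^7+79x^6+242x^5+441x^4+484x^3+316x^2+112x+16$; $f_{33}=x^8+10x^6-8x^5+47x^4-40x^3+82x^2-44x+33$; $f_{35}=x^8-4x^7-6x^6-4x^5-9x^4+4x^3-6x^2+4x+1$; $f_{39}=x^8-6x^7+3x^6+12x^5-23x^4+12x^3+3x^2-6x+1$; $f_{40}=x^8+8x^6-2x^4+8x^2+1$; $f_{41}=x^8-4x^7-8x^6+10x^5+20x^4+8x^3-15x^2-20x-8$; $f_{48}=x^8+14x^4+1$; $f_{50}=x^6-4x^5-10x^3-4x+1$.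 A quadratic point of the form $(x_0,\sqrt{f_N(x_0)})$ with $x_0\in\mathbb{Q}$ is called non-exceptional; "non-cuspidal" means not a cusp of $X_0(N)$. *)

theory Defs
  imports
    "HOL-Number_Theory.Residues"
    "HOL-Algebra.Ideal_Product"
    "HOL-Complex_Analysis.Complex_Analysis"
begin

definition upper_half_plane :: "complex set" where
  "upper_half_plane = {\<tau>. Im \<tau> > 0}"

definition moebius_int :: "int \<Rightarrow> int \<Rightarrow> int \<Rightarrow> int \<Rightarrow> complex \<Rightarrow> complex" where
  "moebius_int a b c d = moebius (of_int a) (of_int b) (of_int c) (of_int d)"

text \<open>
  The expansion of \<open>f\<close> at \<open>\<i>\<infinity>\<close> in the local parameter \<open>exp (2 \<pi> \<i> \<tau> / h)\<close>. As \<open>F\<close> is a Laurent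
  series with only finitely many negative exponents, this includes meromorphy at \<open>\<i>\<infinity>\<close>.
\<close>
definition has_q_expansion :: "nat \<Rightarrow> (complex \<Rightarrow> complex) \<Rightarrow> complex fls \<Rightarrow> bool" where
  "has_q_expansion h f F \<longleftrightarrow>
     (\<exists>g B. g has_laurent_expansion F \<and>
        (\<forall>\<tau>. Im \<tau> > B \<longrightarrow> f \<tau> = g (exp (2 * of_real pi * \<i> * \<tau> / of_nat h))))"

text \<open>
  Meromorphy at all cusps is expressed through all translates by \<open>SL\<^sub>2(\<int>)\<close>; each of them is
  invariant under \<open>\<Gamma>(N)\<close>, hence \<open>N\<close>-periodic. The values of a \<open>nicely_meromorphic_on\<close> function are
  determined everywhere (a pole is given the value \<open>0\<close>), so that the identities between functions
  hold pointwise.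
\<close>
definition modular_function_Gamma0 :: "nat \<Rightarrow> (complex \<Rightarrow> complex) \<Rightarrow> bool" where
  "modular_function_Gamma0 N f \<longleftrightarrow>
     f nicely_meromorphic_on upper_half_plane \<and>
     (\<forall>a b c d. a * d - b * c = 1 \<and> int N dvd c \<longrightarrow>
        (\<forall>\<tau>\<in>upper_half_plane. f (moebius_int a b c d \<tau>) = f \<tau>)) \<and>
     (\<forall>a b c d. a * d - b * c = 1 \<longrightarrow>
        (\<exists>F. has_q_expansion N (\<lambda>\<tau>. f (moebius_int a b c d \<tau>)) F))"

text \<open>
  The function field over \<open>\<rat>\<close> of the canonical model of \<open>X\<^sub>0(N)\<close>: the modular functions whose
  \<open>q\<close>-expansion at the cusp \<open>\<i>\<infinity>\<close> has rational coefficients.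
\<close>
definition X0_function_field :: "nat \<Rightarrow> (complex \<Rightarrow> complex) set" where
  "X0_function_field N =
     {f. modular_function_Gamma0 N f \<and>
         (\<exists>F. has_q_expansion 1 f F \<and> (\<forall>n. fls_nth F n \<in> \<rat>))}"

definition f_X0 :: "nat \<Rightarrow> 'a :: comm_ring_1 \<Rightarrow> 'a" where
  "f_X0 N x =
    (if N = 26 then x^6 - 8*x^5 + 8*x^4 - 18*x^3 + 8*x^2 - 8*x + 1
     else if N = 28 then 4*x^6 - 12*x^5 + 25*x^4 - 30*x^3 + 25*x^2 - 12*x + 4
     else if N = 29 then x^6 - 4*x^5 - 12*x^4 + 2*x^3 + 8*x^2 + 8*x - 7
     else if N = 30 then x^8 + 14*x^7 + 79*x^6 + 242*x^5 + 441*x^4 + 484*x^3 + 316*x^2 + 112*x + 16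
     else if N = 33 then x^8 + 10*x^6 - 8*x^5 + 47*x^4 - 40*x^3 + 82*x^2 - 44*x + 33
     else if N = 35 then x^8 - 4*x^7 - 6*x^6 - 4*x^5 - 9*x^4 + 4*x^3 - 6*x^2 + 4*x + 1
     else if N = 39 then x^8 - 6*x^7 + 3*x^6 + 12*x^5 - 23*x^4 + 12*x^3 + 3*x^2 - 6*x + 1
     else if N = 40 then x^8 + 8*x^6 - 2*x^4 + 8*x^2 + 1
     else if N = 41 then x^8 - 4*x^7 - 8*x^6 + 10*x^5 + 20*x^4 + 8*x^3 - 15*x^2 - 20*x - 8
     else if N = 48 then x^8 + 14*x^4 + 1
     else if N = 50 then x^6 - 4*x^5 - 10*x^3 - 4*x + 1
     else 0)"

definition regular_at :: "(complex \<Rightarrow> complex) \<Rightarrow> complex \<Rightarrow> bool" where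
  "regular_at f \<tau> \<longleftrightarrow> \<not> is_pole f \<tau>"

text \<open>
  \<open>\<xi>\<close> and \<open>\<eta>\<close> are coordinate functions identifying \<open>X\<^sub>0(N)\<close> over \<open>\<rat>\<close> with (the smooth projective
  model of) \<open>y\<^sup>2 = f\<^sub>N(x)\<close>: they satisfy the equation and generate the function field over \<open>\<rat>\<close>.
  As \<open>\<eta>\<^sup>2 \<in> \<rat>(\<xi>)\<close>, the latter means that every element \<open>h\<close> is of the form
  \<open>(P(\<xi>) + Q(\<xi>) \<eta>) / R(\<xi>)\<close>.
\<close>
definition X0_model :: "nat \<Rightarrow> (complex \<Rightarrow> complex) \<Rightarrow> (complex \<Rightarrow> complex) \<Rightarrow> bool" where
  "X0_model N \<xi> \<eta> \<longleftrightarrow>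
     \<xi> \<in> X0_function_field N \<and> \<eta> \<in> X0_function_field N \<and>
     \<not> \<xi> constant_on upper_half_plane \<and>
     (\<forall>\<tau>\<in>upper_half_plane. regular_at \<xi> \<tau> \<and> regular_at \<eta> \<tau> \<longrightarrow> (\<eta> \<tau>)^2 = f_X0 N (\<xi> \<tau>)) \<and>
     (\<forall>h\<in>X0_function_field N. \<exists>P Q R :: rat poly. R \<noteq> 0 \<and>
        (\<forall>\<tau>\<in>upper_half_plane. regular_at \<xi> \<tau> \<and> regular_at \<eta> \<tau> \<and> regular_at h \<tau> \<longrightarrow>
           poly (map_poly of_rat R) (\<xi> \<tau>) * h \<tau> =
           poly (map_poly of_rat P) (\<xi> \<tau>) + poly (map_poly of_rat Q) (\<xi> \<tau>) * \<eta> \<tau>))"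

text \<open>
  The complement of the cusps in \<open>X\<^sub>0(N)(\<complex>)\<close> is \<open>\<Gamma>\<^sub>0(N) \<setminus> \<H>\<close>, so a non-cuspidal affine point of the
  model is one of the form \<open>(\<xi> \<tau>, \<eta> \<tau>)\<close> with \<open>\<tau>\<close> in the upper half plane.
\<close>
definition noncuspidal_point ::
    "(complex \<Rightarrow> complex) \<Rightarrow> (complex \<Rightarrow> complex) \<Rightarrow> complex \<Rightarrow> complex \<Rightarrow> bool" where
  "noncuspidal_point \<xi> \<eta> x y \<longleftrightarrow>
     (\<exists>\<tau>\<in>upper_half_plane. regular_at \<xi> \<tau> \<and> regular_at \<eta> \<tau> \<and> \<xi> \<tau> = x \<and> \<eta> \<tau> = y)"

text \<open>The field \<open>\<rat>(\<surd>D)\<close> inside \<open>\<complex>\<close>.\<close>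
definition quadratic_field :: "rat \<Rightarrow> complex set" where
  "quadratic_field D = {of_rat u + of_rat v * csqrt (of_rat D) | u v. True}"

definition ring_of_integers :: "complex set \<Rightarrow> complex ring" where
  "ring_of_integers K =
     \<lparr>carrier = {z \<in> K. algebraic_int z}, monoid.mult = (*), one = 1, zero = 0, add = (+)\<rparr>"

text \<open>
  Some prime \<open>P\<close> above \<open>p\<close> has ramification index at least \<open>2\<close>, that is, \<open>P\<^sup>2\<close> divides \<open>p \<O>\<^sub>K\<close>;
  in a Dedekind domain this means \<open>p \<in> P\<^sup>2\<close>.
\<close>
definition ramifies_in :: "nat \<Rightarrow> complex set \<Rightarrow> bool" where
  "ramifies_in p K \<longleftrightarrow>
     (\<exists>P. primeideal P (ring_of_integers K) \<and> of_nat p \<in> ideal_prod (ring_of_integers K) P P)"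

end

theory Submission
  imports Defs
begin

text \<open>
  Over \<open>\<rat>(\<surd>a)\<close> the polynomial \<open>f\<^sub>N\<close> splits into two conjugate factors, so that
  \<open>4 f\<^sub>N = A\<^sup>2 - a B\<^sup>2\<close> with \<open>A, B \<in> \<int>[x]\<close>. If \<open>a\<close> is not a square modulo the odd prime \<open>p\<close>, then
  \<open>p\<close> is inert in \<open>\<rat>(\<surd>a)\<close> and every nonzero norm \<open>X\<^sup>2 - a Y\<^sup>2\<close> has even \<open>p\<close>-adic valuation;
  hence \<open>\<rat>(\<surd>f\<^sub>N(x\<^sub>0)) = \<rat>(\<surd>e)\<close> for an integer \<open>e\<close> prime to \<open>p\<close>, and \<open>p\<close> is unramified there.
\<close>

section \<open>Localisation of the rationals at a prime\<close>

text \<open>Membership in the local ring Z_(p). The fraction need not be reduced, and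
  \<open>b \<noteq> 0\<close> is implied because \<open>p\<close> divides 0.\<close>

definition p_integral :: "nat \<Rightarrow> rat \<Rightarrow> bool" where
  "p_integral p r \<longleftrightarrow> (\<exists>a b. \<not> int p dvd b \<and> r = of_int a / of_int b)"

lemma p_integralI: "\<not> int p dvd b \<Longrightarrow> p_integral p (of_int a / of_int b)"
  unfolding p_integral_def by blast

lemma p_integral_of_int [simp]: "prime p \<Longrightarrow> p_integral p (of_int n)"
  using p_integralI[of p 1 n] by (cases "p = 1") auto

lemma p_integral_add:
  assumes "prime p" "p_integral p x" "p_integral p y"
  shows "p_integral p (x + y)"
proof -
  obtain a b c d where "\<not> int p dvd b" "x = of_int a / of_int b" "\<not> int p dvd d" "y = of_int c / of_int d"
    using assms unfolding p_integral_def by blast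
  moreover from this have "b \<noteq> 0" "d \<noteq> 0" by auto
  ultimately have "x + y = of_int (a * d + c * b) / of_int (b * d)" "\<not> int p dvd b * d"
    using assms(1) by (auto simp: field_simps prime_dvd_mult_iff)
  then show ?thesis using p_integralI by metis
qed

lemma p_integral_mult:
  assumes "prime p" "p_integral p x" "p_integral p y"
  shows "p_integral p (x * y)"
proof -
  obtain a b c d where "\<not> int p dvd b" "x = of_int a / of_int b" "\<not> int p dvd d" "y = of_int c / of_int d"
    using assms unfolding p_integral_def by blast
  then have "x * y = of_int (a * c) / of_int (b * d)" "\<not> int p dvd b * d"
    using assms(1) by (auto simp: prime_dvd_mult_iff)
  then show ?thesis using p_integralI by metis
qed

text \<open>Clearing the denominator, which is prime to \<open>p\<close>, shows that p Z_(p) meets Z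
  only in p Z; this brings local divisibility back to the integers.\<close>

lemma dvd_if_p_integral_quotient:
  assumes "prime p" "p_integral p r" "of_int n = of_nat p * r"
  shows "int p dvd n"
proof -
  obtain a b where b: "\<not> int p dvd b" and r: "r = of_int a / of_int b"
    using assms unfolding p_integral_def by blast
  then have "b \<noteq> 0" by auto
  then have "(of_int (n * b) :: rat) = of_int (int p * a)"
    using assms(3) r by simp
  then have "n * b = int p * a" by (simp only: of_int_eq_iff)
  then have "int p dvd n * b" by simp
  then show ?thesis using b assms(1) by (simp add: prime_dvd_mult_iff)
qed

section \<open>Ramification in quadratic fields\<close>

definition quad_elem :: "complex \<Rightarrow> rat \<Rightarrow> rat \<Rightarrow> complex" where
  "quad_elem s u v = of_rat u + of_rat v * s"

lemma quad_elem_add: "quad_elem s a b + quad_elem s c d = quad_elem s (a + c) (b + d)"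
  by (simp add: quad_elem_def of_rat_add algebra_simps)

lemma quad_elem_mult:
  assumes "s ^ 2 = of_int e"
  shows "quad_elem s a b * quad_elem s c d = quad_elem s (a * c + of_int e * b * d) (a * d + b * c)"
proof -
  have "quad_elem s a b * quad_elem s c d =
      of_rat a * of_rat c + of_rat b * of_rat d * s ^ 2 + (of_rat a * of_rat d + of_rat b * of_rat c) * s"
    by (simp add: quad_elem_def algebra_simps power2_eq_square)
  then show ?thesis
    by (simp add: assms quad_elem_def of_rat_add of_rat_mult)
qed

lemma quad_elem_eq_iff:
  assumes "s \<notin> \<rat>"
  shows "quad_elem s a b = quad_elem s c d \<longleftrightarrow> a = c \<and> b = d"
proof
  assume eq: "quad_elem s a b = quad_elem s c d"
  have "b = d"
  proof (rule ccontr)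
    assume "b \<noteq> d"
    then have "(of_rat (b - d) :: complex) \<noteq> 0" by simp
    moreover have "of_rat (b - d) * s = of_rat (c - a)"
      using eq by (simp add: quad_elem_def of_rat_diff algebra_simps)
    ultimately have "s = of_rat ((c - a) / (b - d))"
      by (simp add: of_rat_divide field_simps)
    then show False using assms by simp
  qed
  then show "a = c \<and> b = d" using eq by (simp add: quad_elem_def)
qed simp

text \<open>Conjugation is a ring homomorphism fixing the integers, so an integer polynomial takes
  conjugate values at conjugate arguments, and a monic one that kills an element kills its
  conjugate.\<close>

lemma algebraic_int_quad_elem_conj:
  assumes s: "s ^ 2 = of_int e" "s \<notin> \<rat>" and alg: "algebraic_int (quad_elem s u v)"
  shows "algebraic_int (quad_elem s u (-v))"
proof -
  have ex: "\<exists>A B. poly (map_poly of_int q) (quad_elem s u v) = quad_elem s A B \<and>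
      poly (map_poly of_int q) (quad_elem s u (-v)) = quad_elem s A (-B)" for q :: "int poly"
  proof (induction q)
    case 0
    show ?case by (intro exI[of _ 0]) (simp add: quad_elem_def)
  next
    case (pCons a q)
    then obtain A B where AB: "poly (map_poly of_int q) (quad_elem s u v) = quad_elem s A B"
      "poly (map_poly of_int q) (quad_elem s u (-v)) = quad_elem s A (-B)" by blast
    have a: "of_int a = quad_elem s (of_int a) 0" by (simp add: quad_elem_def)
    show ?case
    \<comment> \<open>One Horner step: \<open>of_int a\<close> plus the product of
      \<open>quad_elem s u v\<close> with \<open>quad_elem s A B\<close>.\<close>
    proof (rule exI[of _ "of_int a + (u * A + of_int e * v * B)"], rule exI[of _ "u * B + v * A"])
      show "poly (map_poly of_int (pCons a q)) (quad_elem s u v) =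
          quad_elem s (of_int a + (u * A + of_int e * v * B)) (u * B + v * A) \<and>
        poly (map_poly of_int (pCons a q)) (quad_elem s u (-v)) =
          quad_elem s (of_int a + (u * A + of_int e * v * B)) (- (u * B + v * A))"
        by (simp add: map_poly_pCons AB quad_elem_mult[OF s(1)])
          (simp add: a quad_elem_add algebra_simps)
    qed
  qed
  obtain q where q: "poly (map_poly of_int q) (quad_elem s u v) = 0" "lead_coeff q = 1"
    using alg by (auto simp: algebraic_int_altdef_ipoly)
  obtain A B where AB: "quad_elem s A B = quad_elem s 0 0"
    "poly (map_poly of_int q) (quad_elem s u (-v)) = quad_elem s A (-B)"
    using ex[of q] q by (auto simp: quad_elem_def)
  then have "A = 0" "B = 0" using quad_elem_eq_iff[OF s(2)] by auto
  then show ?thesis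
    using AB q by (auto simp: algebraic_int_altdef_ipoly quad_elem_def)
qed

text \<open>
  The hypotheses say that trace and norm of the element are divisible by \<open>p\<close>; the conclusion is
  divisibility by \<open>p\<close> in \<open>\<int>\<^sub>(\<^sub>p\<^sub>)[\<surd>e]\<close>.
\<close>
lemma p_integral_of_trace_norm:
  assumes p: "prime p" "\<not> int p dvd 2 * e"
    and tr: "2 * u = of_int (int p * t)" and nm: "u ^ 2 - of_int e * v ^ 2 = of_int (int p * n)"
  shows "p_integral p (u / of_nat p)" "p_integral p (v / of_nat p)"
proof -
  have p0: "(of_nat p :: rat) \<noteq> 0" using p by (auto dest: prime_gt_0_nat)
  have not2: "\<not> int p dvd 2" and note2: "\<not> int p dvd e" using p(2) by auto
  have "u / of_nat p = of_int t / of_int 2" using tr p0 by (simp add: field_simps)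
  then show "p_integral p (u / of_nat p)" using p_integralI not2 by metis
  obtain x y where v: "v = of_int x / of_int y" "y > 0" "coprime x y"
    using quotient_of_div quotient_of_denom_pos quotient_of_coprime by (metis surj_pair)
  \<comment> \<open>Only \<open>2 * u\<close> is known to be an integer, so the norm equation is
    multiplied by 4 and by the squared denominator \<open>y ^ 2\<close>.\<close>
  have "of_int (4 * e * x ^ 2) = of_int (4 * e) * v ^ 2 * of_int (y ^ 2)"
    using v by (simp add: power_divide)
  also have "of_int (4 * e) * v ^ 2 = (2 * u) ^ 2 - 4 * of_int (int p * n)"
    using nm by (simp add: algebra_simps power_mult_distrib)
  also have "\<dots> = of_int (int p * (int p * t ^ 2 - 4 * n))"
    unfolding tr by (simp add: algebra_simps power2_eq_square)
  finally have "(of_int (4 * e * x ^ 2) :: rat) = of_int (int p * ((int p * t ^ 2 - 4 * n) * y ^ 2))"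
    by simp
  then have "4 * e * x ^ 2 = int p * ((int p * t ^ 2 - 4 * n) * y ^ 2)"
    by (simp only: of_int_eq_iff)
  then have "int p dvd (2 * e) * (2 * x ^ 2)"
    by (simp add: mult_ac)
  then have "int p dvd x"
    using p not2 by (metis prime_dvd_mult_iff prime_dvd_power prime_int_nat_transfer prime_nat_int_transfer)
  then obtain k where k: "x = int p * k" by auto
  have "\<not> int p dvd y"
    using v(3) \<open>int p dvd x\<close> p(1) by (meson coprime_common_divisor not_prime_unit prime_nat_int_transfer)
  moreover have "v / of_nat p = of_int k / of_int y" using p0 v k by simp
  ultimately show "p_integral p (v / of_nat p)" using p_integralI by metis
qed

text \<open>Membership in \<open>p ^ k\<close> times Z_(p)[s]. For \<open>p\<close> prime to
  \<open>2 * e\<close> this ring contains all integers of the field, whether or not \<open>e\<close>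
  is squarefree.\<close>

definition p_divisible :: "nat \<Rightarrow> complex \<Rightarrow> nat \<Rightarrow> complex \<Rightarrow> bool" where
  "p_divisible p s k z \<longleftrightarrow>
     (\<exists>a b. p_integral p a \<and> p_integral p b \<and> z = of_nat p ^ k * quad_elem s a b)"

lemma p_divisible_add:
  assumes "prime p" "p_divisible p s k y" "p_divisible p s k z"
  shows "p_divisible p s k (y + z)"
proof -
  obtain a b c d where "p_integral p a" "p_integral p b" "p_integral p c" "p_integral p d"
    "y = of_nat p ^ k * quad_elem s a b" "z = of_nat p ^ k * quad_elem s c d"
    using assms unfolding p_divisible_def by blast
  then show ?thesis
    unfolding p_divisible_def using assms(1)
    by (metis distrib_left p_integral_add quad_elem_add)
qed

lemma p_divisible_mult:
  assumes "prime p" "s ^ 2 = of_int e" "p_divisible p s j y" "p_divisible p s k z"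
  shows "p_divisible p s (j + k) (y * z)"
proof -
  obtain a b c d where *: "p_integral p a" "p_integral p b" "p_integral p c" "p_integral p d"
    and yz: "y = of_nat p ^ j * quad_elem s a b" "z = of_nat p ^ k * quad_elem s c d"
    using assms unfolding p_divisible_def by blast
  have "y * z = of_nat p ^ (j + k) * (quad_elem s a b * quad_elem s c d)"
    unfolding yz by (simp add: power_add mult_ac)
  then have "y * z = of_nat p ^ (j + k) * quad_elem s (a * c + of_int e * b * d) (a * d + b * c)"
    by (simp only: quad_elem_mult[OF assms(2)])
  moreover have "p_integral p (a * c + of_int e * b * d)" "p_integral p (a * d + b * c)"
    using * assms(1) by (auto intro!: p_integral_add p_integral_mult)
  ultimately show ?thesis unfolding p_divisible_def by blast
qed

lemma p_divisible_quad_elemD: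
  assumes "s \<notin> \<rat>" "prime p" "p_divisible p s k (quad_elem s u v)"
  shows "\<exists>a. p_integral p a \<and> u = of_nat p ^ k * a"
proof -
  obtain a b where ab: "p_integral p a" "quad_elem s u v = of_nat p ^ k * quad_elem s a b"
    using assms unfolding p_divisible_def by blast
  moreover have "of_nat p ^ k * quad_elem s a b = quad_elem s (of_nat p ^ k * a) (of_nat p ^ k * b)"
    by (simp add: quad_elem_def of_rat_mult of_rat_power algebra_simps)
  ultimately show ?thesis using quad_elem_eq_iff[OF assms(1)] by metis
qed

lemma p_divisible_of_trace_norm:
  assumes "prime p" "\<not> int p dvd 2 * e"
    and "2 * u = of_int (int p * t)" "u ^ 2 - of_int e * v ^ 2 = of_int (int p * n)"
  shows "p_divisible p s 1 (quad_elem s u v)"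
proof -
  have "(of_nat p :: complex) \<noteq> 0" using assms(1) by (auto dest: prime_gt_0_nat)
  then have "quad_elem s u v = of_nat p ^ 1 * quad_elem s (u / of_nat p) (v / of_nat p)"
    by (simp add: quad_elem_def of_rat_divide field_simps)
  then show ?thesis
    using p_integral_of_trace_norm[OF assms] unfolding p_divisible_def by blast
qed


lemma quad_elem_trace_norm:
  assumes "s ^ 2 = of_int e"
  shows "quad_elem s u v + quad_elem s u (-v) = of_rat (2 * u)"
    and "quad_elem s u v * quad_elem s u (-v) = of_rat (u ^ 2 - of_int e * v ^ 2)"
proof -
  show "quad_elem s u v + quad_elem s u (-v) = of_rat (2 * u)"
    by (simp add: quad_elem_def of_rat_mult of_rat_minus)
  show "quad_elem s u v * quad_elem s u (-v) = of_rat (u ^ 2 - of_int e * v ^ 2)"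
    by (simp add: quad_elem_mult[OF assms]) (simp add: quad_elem_def power2_eq_square algebra_simps)
qed

text \<open>
  Writing \<open>x\<^sup>-\<close> for the conjugate, \<open>x, z \<in> P\<close> implies that \<open>z x\<^sup>-\<close> has trace and norm divisible by \<open>p\<close> and
  \<open>p\<^sup>2\<close>, so it is divisible by \<open>p\<close> in \<open>\<int>\<^sub>(\<^sub>p\<^sub>)[\<surd>e]\<close>. Expanding \<open>p \<in> P\<^sup>2\<close>, the product \<open>p (x\<^sup>-)\<^sup>2\<close> is
  divisible by \<open>p\<^sup>2\<close>, which forces \<open>p\<close> to divide the trace of \<open>x\<close> and then \<open>x\<close> itself. So
  \<open>p \<in> P\<^sup>2\<close> would be divisible by \<open>p\<^sup>2\<close>.
\<close>
lemma not_ramifies_in: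
  assumes p: "prime p" "\<not> int p dvd 2 * e" and s: "s ^ 2 = of_int e" "s \<notin> \<rat>"
  shows "\<not> ramifies_in p {quad_elem s u v | u v. True}"
proof
  define K where "K = {quad_elem s u v | u v. True}"
  define R where "R = ring_of_integers K"
  assume "ramifies_in p {quad_elem s u v | u v. True}"
  then obtain P where P: "primeideal P R" and pP: "of_nat p \<in> ideal_prod R P P"
    unfolding ramifies_in_def R_def K_def by blast
  interpret primeideal P R by fact
  have carr: "z \<in> carrier R \<longleftrightarrow> (\<exists>u v. z = quad_elem s u v) \<and> algebraic_int z" for z
    by (auto simp: R_def K_def ring_of_integers_def)
  have ops: "x \<otimes>\<^bsub>R\<^esub> y = x * y" "x \<oplus>\<^bsub>R\<^esub> y = x + y" "\<one>\<^bsub>R\<^esub> = 1" for x y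
    by (simp_all add: R_def ring_of_integers_def)
  have Pmult: "x * y \<in> P" "y * x \<in> P" if "x \<in> P" "y \<in> carrier R" for x y
    using I_r_closed[OF that] I_l_closed[OF that] by (simp_all add: ops)
  have Padd: "x + y \<in> P" if "x \<in> P" "y \<in> P" for x y
    using additive_subgroup.a_closed[OF additive_subgroup_axioms that] by (simp add: ops)
  have Pint: "algebraic_int z" "z \<in> carrier R" if "z \<in> P" for z
    using Icarr[OF that] carr by auto
  have int_carr: "of_int n \<in> carrier R" for n
  proof -
    have "of_int n = quad_elem s (of_int n) 0" by (simp add: quad_elem_def)
    then show ?thesis unfolding carr by (metis algebraic_int_of_int)
  qed
  have "of_nat p \<in> P"
    using pP ideal_prod_inter[OF is_ideal is_ideal] by blast
  \<comment> \<open>\<open>P\<close> contracts to p Z: an integer prime to \<open>p\<close> in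
    \<open>P\<close> would by Bezout put 1 into a proper ideal.\<close>
  have P_dvd: "int p dvd n" if "of_int n \<in> P" for n
  proof (rule ccontr)
    assume "\<not> int p dvd n"
    then have "coprime (int p) n" using p(1) by (simp add: prime_imp_coprime)
    then obtain a b where ab: "a * int p + b * n = 1"
      by (metis bezout_int coprime_imp_gcd_eq_1)
    have "of_nat p * of_int a + of_int n * of_int b \<in> P"
      using that \<open>of_nat p \<in> P\<close> int_carr by (intro Padd Pmult)
    also have "of_nat p * of_int a + of_int n * of_int b = (of_int (a * int p + b * n) :: complex)"
      by (simp add: algebra_simps)
    finally have "1 \<in> P" by (simp add: ab)
    then show False using one_imp_carrier I_notcarr by (simp add: ops)
  qed
  have P_rat: "\<exists>t. r = of_int (int p * t)" if "of_rat r \<in> P" for r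
  proof -
    have "(of_rat r :: complex) \<in> \<int>"
      using Pint(1)[OF that] rational_algebraic_int_is_int Rats_of_rat by blast
    then obtain n where n: "(of_rat r :: complex) = of_int n" by (auto elim: Ints_cases)
    then have "(of_rat r :: complex) = of_rat (of_int n)" by simp
    then have "r = of_int n" by (simp only: of_rat_eq_iff)
    then show ?thesis using P_dvd[of n] that n by auto
  qed
  \<comment> \<open>Conjugates are only placed in the ring of integers; nothing says that
    \<open>P\<close> is stable under conjugation.\<close>
  have conj: "quad_elem s u (-v) \<in> carrier R" if "quad_elem s u v \<in> P" for u v
    using algebraic_int_quad_elem_conj[OF s Pint(1)[OF that]] unfolding carr by blast
  have norm: "\<exists>n. u ^ 2 - of_int e * v ^ 2 = of_int (int p * n)" if "quad_elem s u v \<in> P" for u v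
    using Pmult(1)[OF that conj[OF that]] P_rat by (simp only: quad_elem_trace_norm[OF s(1)])
  have step: "p_divisible p s 1 (z * quad_elem s u (-v))"
    if x: "quad_elem s u v \<in> P" and z: "z \<in> P" for u v z
  proof -
    obtain c d where zc: "z = quad_elem s c d" using Pint(2)[OF z] carr by auto
    have zP: "quad_elem s c d \<in> P" using z zc by simp
    define f g where "f = c * u - of_int e * d * v" and "g = d * u - c * v"
    \<comment> \<open>The two products are conjugate to each other, and each has one factor in
      \<open>P\<close>; hence their sum, a rational trace, lies in \<open>P\<close>.\<close>
    have "quad_elem s c d * quad_elem s u (-v) \<in> P" "quad_elem s c (-d) * quad_elem s u v \<in> P"
      using Pmult zP x conj by auto
    moreover have fg: "quad_elem s c d * quad_elem s u (-v) = quad_elem s f g"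
      "quad_elem s c (-d) * quad_elem s u v = quad_elem s f (-g)"
      unfolding quad_elem_mult[OF s(1)] f_def g_def by (simp_all add: algebra_simps)
    ultimately have "quad_elem s f g + quad_elem s f (-g) \<in> P" using Padd by simp
    then obtain t where t: "2 * f = of_int (int p * t)"
      using P_rat unfolding quad_elem_trace_norm[OF s(1)] by blast
    obtain m n where mn: "u ^ 2 - of_int e * v ^ 2 = of_int (int p * m)"
      "c ^ 2 - of_int e * d ^ 2 = of_int (int p * n)"
      using norm x zP by blast
    have "f ^ 2 - of_int e * g ^ 2 = (u ^ 2 - of_int e * v ^ 2) * (c ^ 2 - of_int e * d ^ 2)"
      by (simp add: f_def g_def power2_eq_square algebra_simps)
    also have "\<dots> = of_int (int p * (m * int p * n))" unfolding mn by simp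
    finally show ?thesis
      unfolding zc fg by (rule p_divisible_of_trace_norm[OF p t])
  qed
  have P1: "p_divisible p s 1 x" if "x \<in> P" for x
  proof -
    obtain u v where x: "x = quad_elem s u v" using Pint(2) \<open>x \<in> P\<close> carr by blast
    then have xP: "quad_elem s u v \<in> P" using \<open>x \<in> P\<close> by simp
    let ?y = "quad_elem s u (-v)"
    \<comment> \<open>On a generator \<open>i * j\<close> each factor takes one copy of
      \<open>?y\<close>, so \<open>step\<close> applies to both.\<close>
    have "p_divisible p s 2 (z * (?y * ?y))" if "z \<in> ideal_prod R P P" for z
      using that
    proof (induction rule: ideal_prod.induct)
      case (prod i j)
      have "p_divisible p s (1 + 1) ((i * ?y) * (j * ?y))"
        by (rule p_divisible_mult[OF p(1) s(1) step[OF xP prod(1)] step[OF xP prod(2)]])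
      then show ?case by (simp add: ops mult_ac numeral_2_eq_2)
    next
      case (sum a b)
      then show ?case
        using p_divisible_add[OF p(1) sum.IH] by (simp only: ops distrib_right)
    qed
    then have "p_divisible p s 2 (of_nat p * (?y * ?y))" using pP by blast
    moreover have "of_nat p * (?y * ?y) =
        quad_elem s (of_nat p * (u ^ 2 + of_int e * v ^ 2)) (of_nat p * (- 2 * u * v))"
      unfolding quad_elem_mult[OF s(1)]
      by (simp add: quad_elem_def of_rat_mult of_rat_add power2_eq_square of_rat_minus algebra_simps)
    ultimately obtain a where a: "p_integral p a"
      "of_nat p * (u ^ 2 + of_int e * v ^ 2) = of_nat p ^ 2 * a"
      using p_divisible_quad_elemD[OF s(2) p(1)] by metis
    have p0: "(of_nat p :: rat) \<noteq> 0" using p by (auto dest: prime_gt_0_nat)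
    then have a2: "u ^ 2 + of_int e * v ^ 2 = of_nat p * a"
      using a(2) by (simp add: power2_eq_square)
    obtain n where n: "u ^ 2 - of_int e * v ^ 2 = of_int (int p * n)" using norm[OF xP] by blast
    have "quad_elem s u v \<oplus>\<^bsub>R\<^esub> ?y \<in> carrier R"
      using conj[OF xP] Pint(2)[OF xP] by (rule a_closed[rotated])
    then have "algebraic_int (of_rat (2 * u) :: complex)"
      by (simp add: ops carr quad_elem_trace_norm(1)[OF s(1)] del: of_rat_mult)
    then have "(of_rat (2 * u) :: complex) \<in> \<int>"
      using rational_algebraic_int_is_int Rats_of_rat by blast
    then obtain t where "(of_rat (2 * u) :: complex) = of_int t" by (auto elim: Ints_cases)
    then have "(of_rat (2 * u) :: complex) = of_rat (of_int t)" by simp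
    then have t: "2 * u = of_int t" by (simp only: of_rat_eq_iff)
    \<comment> \<open>The squared trace \<open>4 * u ^ 2\<close> is twice the rational coordinate of
      the squared conjugate plus twice the norm; both lie in p Z_(p).\<close>
    have "of_int (t ^ 2) = 2 * (u ^ 2 + of_int e * v ^ 2) + 2 * (u ^ 2 - of_int e * v ^ 2)"
      using t[symmetric] by (simp add: power2_eq_square)
    also have "\<dots> = of_nat p * (of_int 2 * a + of_int (2 * n))"
      unfolding a2 n by (simp add: algebra_simps)
    finally have "int p dvd t ^ 2"
      using a(1) p(1) by (elim dvd_if_p_integral_quotient[rotated -1])
        (auto intro!: p_integral_add p_integral_mult p_integral_of_int simp del: of_int_numeral of_int_mult)
    then have "int p dvd t" using p(1) prime_dvd_power[of "int p" t 2] by simp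
    then obtain t' where "t = int p * t'" by auto
    then have "2 * u = of_int (int p * t')" using t by simp
    then show ?thesis
      unfolding x using n by (rule p_divisible_of_trace_norm[OF p])
  qed
  have "p_divisible p s 2 z" if "z \<in> ideal_prod R P P" for z
    using that
  proof (induction rule: ideal_prod.induct)
    case (prod i j)
    have "p_divisible p s (1 + 1) (i * j)"
      by (rule p_divisible_mult[OF p(1) s(1) P1[OF prod(1)] P1[OF prod(2)]])
    then show ?case by (simp add: ops numeral_2_eq_2)
  next
    case (sum a b)
    then show ?case using p_divisible_add[OF p(1) sum.IH] by (simp only: ops)
  qed
  \<comment> \<open>Divisibility of \<open>p\<close> itself by \<open>p ^ 2\<close> would make
    \<open>p\<close> invertible in Z_(p).\<close>
  then have "p_divisible p s 2 (quad_elem s (of_nat p) 0)"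
    using pP by (simp add: quad_elem_def)
  then obtain a where a: "p_integral p a" "of_nat p = of_nat p ^ 2 * a"
    using p_divisible_quad_elemD[OF s(2) p(1)] by metis
  have "(of_nat p :: rat) \<noteq> 0" using p by (auto dest: prime_gt_0_nat)
  then have "of_int 1 = of_nat p * a" using a(2) by (simp add: power2_eq_square)
  then have "int p dvd 1" using dvd_if_p_integral_quotient[OF p(1) a(1)] by blast
  then show False using p(1) by (auto simp: zdvd1_eq)
qed

section \<open>Norm forms\<close>

text \<open>If \<open>p\<close> did not divide \<open>y\<close>, dividing by \<open>y ^ 2\<close>
  modulo \<open>p\<close> would present \<open>a\<close> as a square. So \<open>p\<close> divides
  \<open>y\<close>, and then \<open>x ^ 2\<close>.\<close>

lemma dvd_both_if_not_QuadRes: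
  assumes p: "prime p" "\<not> QuadRes (int p) a" and d: "int p dvd x ^ 2 - a * y ^ 2"
  shows "int p dvd x \<and> int p dvd y"
proof -
  have pp: "prime (int p)" using p by simp
  have "int p dvd y"
  proof (rule ccontr)
    assume "\<not> int p dvd y"
    then have "coprime y (int p)" using pp by (metis prime_imp_coprime coprime_commute)
    then obtain z where z: "[y * z = 1] (mod int p)" using cong_solve_coprime_int by blast
    have "[x ^ 2 = a * y ^ 2] (mod int p)" using d by (simp add: cong_iff_dvd_diff)
    then have "[x ^ 2 * z ^ 2 = a * y ^ 2 * z ^ 2] (mod int p)" by (rule cong_scalar_right)
    then have "[(x * z) ^ 2 = a * (y * z) ^ 2] (mod int p)" by (simp add: power_mult_distrib mult_ac)
    moreover have "[a * (y * z) ^ 2 = a * 1 ^ 2] (mod int p)"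
      using z by (intro cong_mult cong_pow cong_refl)
    ultimately have "QuadRes (int p) a" unfolding QuadRes_def by (metis cong_trans mult_1_right power_one)
    then show False using p by simp
  qed
  then have "int p dvd (x ^ 2 - a * y ^ 2) + a * y ^ 2" using d by (intro dvd_add dvd_mult) (auto simp: power2_eq_square)
  then have "int p dvd x" using pp prime_dvd_power[of "int p" x 2] by simp
  with \<open>int p dvd y\<close> show ?thesis by simp
qed

text \<open>Descent: whenever \<open>p\<close> divides the value it divides both arguments, so
  exactly two factors \<open>p\<close> split off and the sum of absolute values drops.\<close>

lemma even_multiplicity_if_not_QuadRes:
  assumes p: "prime p" "\<not> QuadRes (int p) a" and "x ^ 2 - a * y ^ 2 \<noteq> 0"
  shows "even (multiplicity (int p) (x ^ 2 - a * y ^ 2))"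
  using assms(3)
proof (induction "nat (\<bar>x\<bar> + \<bar>y\<bar>)" arbitrary: x y rule: less_induct)
  case less
  have pp: "prime (int p)" using p by simp
  show ?case
  proof (cases "int p dvd x ^ 2 - a * y ^ 2")
    case False
    then show ?thesis by (simp add: not_dvd_imp_multiplicity_0)
  next
    case True
    then obtain x' y' where xy: "x = int p * x'" "y = int p * y'"
      using dvd_both_if_not_QuadRes[OF p] unfolding dvd_def by blast
    have eq: "x ^ 2 - a * y ^ 2 = int p ^ 2 * (x' ^ 2 - a * y' ^ 2)"
      by (simp add: xy power_mult_distrib algebra_simps)
    then have nz: "x' ^ 2 - a * y' ^ 2 \<noteq> 0" using less.prems by auto
    then have "\<bar>x'\<bar> + \<bar>y'\<bar> > 0" by (cases "x' = 0"; cases "y' = 0") auto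
    moreover have "int p > 1" using p(1) prime_gt_1_nat by auto
    ultimately have "\<bar>x'\<bar> + \<bar>y'\<bar> < int p * (\<bar>x'\<bar> + \<bar>y'\<bar>)" by simp
    then have "nat (\<bar>x'\<bar> + \<bar>y'\<bar>) < nat (\<bar>x\<bar> + \<bar>y\<bar>)"
      by (simp add: xy abs_mult algebra_simps)
    then have "even (multiplicity (int p) (x' ^ 2 - a * y' ^ 2))" using less.hyps nz by blast
    moreover have "multiplicity (int p) (x ^ 2 - a * y ^ 2) =
        2 + multiplicity (int p) (x' ^ 2 - a * y' ^ 2)"
      unfolding eq using pp nz
      by (subst prime_elem_multiplicity_mult_distrib)
        (auto simp: prime_elem_multiplicity_power_distrib multiplicity_same_power)
    ultimately show ?thesis by simp
  qed
qed

section \<open>From the valuation of the radicand to ramification\<close>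

lemma quad_elem_range_scale:
  assumes "r \<noteq> 0"
  shows "{quad_elem (of_rat r * s) u v | u v. True} = {quad_elem s u v | u v. True}"
proof -
  have "quad_elem (of_rat r * s) u v = quad_elem s u (v * r)" for u v
    by (simp add: quad_elem_def of_rat_mult)
  moreover from this have "quad_elem s u v = quad_elem (of_rat r * s) u (v / r)" for u v
    using assms by simp
  ultimately show ?thesis by blast
qed

text \<open>The field depends on \<open>D\<close>, that is on \<open>u * v\<close>, only up to
  rational squares. An even power of \<open>p\<close> is such a square; removing it leaves a
  radicand prime to \<open>p\<close>, where \<open>not_ramifies_in\<close> applies.\<close>

lemma ramifies_in_quadratic_field_imp_odd_multiplicity:
  assumes p: "prime p" "p \<noteq> 2" and D: "\<nexists>r. D = r ^ 2"
    and uv: "D = of_int u / of_int v" "v \<noteq> 0"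
    and ram: "ramifies_in p (quadratic_field D)"
  shows "odd (multiplicity (int p) (u * v))"
proof
  assume ev: "even (multiplicity (int p) (u * v))"
  have "u \<noteq> 0" using D uv by (metis div_0 of_int_0 zero_power2)
  then have "u * v \<noteq> 0" using uv by simp
  have pp: "prime (int p)" using p by simp
  then obtain e where e: "u * v = int p ^ multiplicity (int p) (u * v) * e" "\<not> int p dvd e"
    using \<open>u * v \<noteq> 0\<close> by (metis multiplicity_decompose' not_prime_unit)
  obtain k where k: "multiplicity (int p) (u * v) = 2 * k" using ev by auto
  \<comment> \<open>Chosen to give \<open>D = r ^ 2 * of_int e\<close>, as \<open>D\<close> is
    \<open>u * v\<close> over \<open>v ^ 2\<close> and \<open>u * v\<close> has
    \<open>p\<close>-part \<open>p ^ (2 * k)\<close>.\<close>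
  define r where "r = (of_nat p ^ k / of_int v :: rat)"
  have p0: "p \<noteq> 0" using p by (auto dest: prime_gt_0_nat)
  have r0: "r \<noteq> 0" using p0 uv by (simp add: r_def)
  have "of_int (u * v) = (of_nat p ^ k) ^ 2 * (of_int e :: rat)"
    by (subst e(1)) (simp add: k power_mult mult.commute)
  moreover have "D = of_int (u * v) / of_int v ^ 2"
    using uv by (simp add: power2_eq_square)
  ultimately have De: "D = r ^ 2 * of_int e"
    by (simp add: r_def power_divide)
  \<comment> \<open>Dividing the given root of \<open>D\<close> by \<open>r\<close> avoids comparing
    branches of the square root.\<close>
  define s where "s = csqrt (of_rat D) / of_rat r"
  have s: "s ^ 2 = of_int e"
    using r0 by (simp add: s_def power_divide De of_rat_mult of_rat_power)
  have "s \<notin> \<rat>"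
  proof
    assume "s \<in> \<rat>"
    then obtain q where "s = of_rat q" by (auto elim: Rats_cases)
    then have "(of_rat (q ^ 2) :: complex) = of_rat (of_int e)" using s by (simp add: of_rat_power)
    then have "q ^ 2 = of_int e" by (simp only: of_rat_eq_iff)
    then have "D = (r * q) ^ 2" using De by (simp add: power_mult_distrib)
    then show False using D by blast
  qed
  moreover have "\<not> int p dvd 2 * e"
  proof -
    have "\<not> int p dvd 2" using p pp primes_dvd_imp_eq[of "int p" 2] by auto
    then show ?thesis using e(2) pp by (simp add: prime_dvd_mult_iff)
  qed
  moreover have "quadratic_field D = {quad_elem s u v | u v. True}"
  proof -
    have "csqrt (of_rat D) = of_rat r * s" using r0 by (simp add: s_def)
    then have "quadratic_field D = {quad_elem (of_rat r * s) u v | u v. True}"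
      by (simp add: quadratic_field_def quad_elem_def)
    then show ?thesis using quad_elem_range_scale[OF r0] by simp
  qed
  ultimately show False using not_ramifies_in[OF p(1) _ s] ram by simp
qed

text \<open>Clearing denominators turns a square multiple of \<open>u * v\<close> into an integer
  value of the norm form. For a nonresidue \<open>a\<close> its valuation is even, whereas
  ramification at an odd \<open>p\<close> makes that of \<open>u * v\<close> odd.\<close>

lemma QuadRes_if_ramifies_in_norm:
  assumes p: "prime p" and D: "\<nexists>r. D = r ^ 2"
    and ram: "ramifies_in p (quadratic_field D)"
    and norm: "4 * D = A ^ 2 - of_int a * B ^ 2"
  shows "QuadRes (int p) a"
proof (cases "p = 2")
  case True
  \<comment> \<open>Modulo 2 every integer is a square, since 0 and 1 are their own squares.\<close>
  have "[(a mod 2) ^ 2 = a] (mod 2)"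
    by (cases "even a") (simp_all add: cong_iff_dvd_diff mod_2_eq_odd)
  then show ?thesis using True by (auto simp: QuadRes_def)
next
  case False
  obtain u v where uv: "D = of_int u / of_int v" "v > 0"
    using quotient_of_div quotient_of_denom_pos by (metis surj_pair)
  obtain k l where kl: "A = of_int k / of_int l" "l > 0"
    using quotient_of_div quotient_of_denom_pos by (metis surj_pair)
  obtain m n where mn: "B = of_int m / of_int n" "n > 0"
    using quotient_of_div quotient_of_denom_pos by (metis surj_pair)
  show ?thesis
  proof (rule ccontr)
    assume nq: "\<not> QuadRes (int p) a"
    have pp: "prime (int p)" using p by simp
    have odd: "odd (multiplicity (int p) (u * v))"
      using ramifies_in_quadratic_field_imp_odd_multiplicity[OF p False D _ _ ram] uv by auto
    \<comment> \<open>\<open>multiplicity\<close> assigns the even value 0 to the zero element, so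
      oddness excludes \<open>u * v = 0\<close>.\<close>
    then have uv0: "u * v \<noteq> 0" by (metis multiplicity_zero even_zero)
    have "of_int ((2 * l * n) ^ 2 * (u * v)) = (of_int (l * n * v)) ^ 2 * (4 * D)"
      using uv by (simp add: power2_eq_square)
    also have "\<dots> = of_int ((k * n * v) ^ 2 - a * (m * l * v) ^ 2)"
    proof -
      have "of_int k = A * of_int l" "of_int m = B * of_int n" using kl mn by simp_all
      then show ?thesis unfolding norm by (simp add: power2_eq_square algebra_simps)
    qed
    finally have eq: "(2 * l * n) ^ 2 * (u * v) = (k * n * v) ^ 2 - a * (m * l * v) ^ 2"
      by (simp only: of_int_eq_iff)
    have nz: "2 * l * n \<noteq> 0" using kl mn by simp
    have "even (multiplicity (int p) ((2 * l * n) ^ 2 * (u * v)))"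
      unfolding eq using nz uv0 eq by (intro even_multiplicity_if_not_QuadRes[OF p nq]) auto
    moreover have "multiplicity (int p) ((2 * l * n) ^ 2 * (u * v)) =
        2 * multiplicity (int p) (2 * l * n) + multiplicity (int p) (u * v)"
      using pp nz uv0 prime_elem_multiplicity_mult_distrib[of "int p" "(2 * l * n) ^ 2" "u * v"]
        prime_elem_multiplicity_power_distrib[of "int p" "2 * l * n" 2] by auto
    ultimately show False using odd by simp
  qed
qed

text \<open>\<open>A\<close> and \<open>B\<close> are read off from a factor g of
  \<open>f_X0 N\<close> over the field generated by the square root of \<open>a\<close>, through 2 g
  = A + B sqrt(a). The 4 absorbs halves in the coefficients of g, as for
  \<open>N = 26\<close>.\<close>

lemma f_X0_eq_norm:
  fixes x :: rat
  assumes "(N, a) \<in> {(26, 13), (28, -7), (29, 29), (30, 5), (33, -11), (35, 5), (39, 13),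
                     (40, -1), (40, 5), (41, 41), (48, -1), (48, 3), (50, 5)}"
  shows "\<exists>A B. 4 * f_X0 N x = A ^ 2 - of_int a * B ^ 2"
proof -
  consider
    "N = 26" "a = 13"
  | "N = 28" "a = -7"
  | "N = 29" "a = 29"
  | "N = 30" "a = 5"
  | "N = 33" "a = -11"
  | "N = 35" "a = 5"
  | "N = 39" "a = 13"
  | "N = 40" "a = -1"
  | "N = 40" "a = 5"
  | "N = 41" "a = 41"
  | "N = 48" "a = -1"
  | "N = 48" "a = 3"
  | "N = 50" "a = 5"
    using assms(1) by auto
  then show ?thesis
  proof cases
    case 1
    then have "4 * f_X0 N x = (2*x^3 - 8*x^2 + 5*x - 11) ^ 2 - of_int a * (2*x^2 - x + 3) ^ 2"
      by (simp add: f_X0_def power2_eq_square eval_nat_numeral algebra_simps)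
    then show ?thesis by blast
  next
    case 2
    then have "4 * f_X0 N x = (4*x^3 - 6*x^2 - 6*x + 4) ^ 2 - of_int a * (4*x^2 - 4*x) ^ 2"
      by (simp add: f_X0_def power2_eq_square eval_nat_numeral algebra_simps)
    then show ?thesis by blast
  next
    case 3
    then have "4 * f_X0 N x = (2*x^3 - 4*x^2 + 13*x - 1) ^ 2 - of_int a * (2*x^2 - x + 1) ^ 2"
      by (simp add: f_X0_def power2_eq_square eval_nat_numeral algebra_simps)
    then show ?thesis by blast
  next
    case 4
    then have "4 * f_X0 N x = (2*x^4 + 14*x^3 + 30*x^2 + 32*x + 12) ^ 2 - of_int a * (4*x^2 + 8*x + 4) ^ 2"
      by (simp add: f_X0_def power2_eq_square eval_nat_numeral algebra_simps)
    then show ?thesis by blast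
  next
    case 5
    then have "4 * f_X0 N x = (2*x^4 + 10*x^2 - 8*x + 11) ^ 2 - of_int a * (2*x^2 + 1) ^ 2"
      by (simp add: f_X0_def power2_eq_square eval_nat_numeral algebra_simps)
    then show ?thesis by blast
  next
    case 6
    then have "4 * f_X0 N x = (2*x^4 - 4*x^3 + 10*x^2 - 4*x + 3) ^ 2 - of_int a * (4*x^3 - 2*x^2 + 4*x - 1) ^ 2"
      by (simp add: f_X0_def power2_eq_square eval_nat_numeral algebra_simps)
    then show ?thesis by blast
  next
    case 7
    then have "4 * f_X0 N x = (2*x^4 - 6*x^3 - 6*x^2 - 6*x + 2) ^ 2 - of_int a * (4*x^2) ^ 2"
      by (simp add: f_X0_def power2_eq_square eval_nat_numeral algebra_simps)
    then show ?thesis by blast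
  next
    case 8
    then have "4 * f_X0 N x = (2*x^4 + 4*x^2 + 2) ^ 2 - of_int a * (4*x^3 - 4*x) ^ 2"
      by (simp add: f_X0_def power2_eq_square eval_nat_numeral algebra_simps)
    then show ?thesis by blast
  next
    case 9
    then have "4 * f_X0 N x = (2*x^4 + 8*x^2 + 2) ^ 2 - of_int a * (4*x^2) ^ 2"
      by (simp add: f_X0_def power2_eq_square eval_nat_numeral algebra_simps)
    then show ?thesis by blast
  next
    case 10
    then have "4 * f_X0 N x = (2*x^4 - 4*x^3 - 12*x^2 - 14*x - 3) ^ 2 - of_int a * (2*x^2 + 2*x + 1) ^ 2"
      by (simp add: f_X0_def power2_eq_square eval_nat_numeral algebra_simps)
    then show ?thesis by blast
  next
    case 11
    \<comment> \<open>Completing the square in two ways gives (x^4 - 1)^2 + 16 x^4 here and (x^4 +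
      7)^2 - 48 in the next case, whence the values -1 and 3 for \<open>a\<close>.\<close>
    then have "4 * f_X0 N x = (2*x^4 - 2) ^ 2 - of_int a * (8*x^2) ^ 2"
      by (simp add: f_X0_def power2_eq_square eval_nat_numeral algebra_simps)
    then show ?thesis by blast
  next
    case 12
    then have "4 * f_X0 N x = (2*x^4 + 14) ^ 2 - of_int a * 8 ^ 2"
      by (simp add: f_X0_def power2_eq_square eval_nat_numeral algebra_simps)
    then show ?thesis by blast
  next
    case 13
    then have "4 * f_X0 N x = (2*x^3 - 4*x^2 + x - 3) ^ 2 - of_int a * (2*x^2 + x + 1) ^ 2"
      by (simp add: f_X0_def power2_eq_square eval_nat_numeral algebra_simps)
    then show ?thesis by blast
  qed
qed

theorem theorem2p8:
  fixes N :: nat and a :: int and x0 :: rat and p :: nat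
    and \<xi> \<eta> :: "complex \<Rightarrow> complex"
  assumes "(N, a) \<in> {(26, 13), (28, -7), (29, 29), (30, 5), (33, -11), (35, 5), (39, 13),
                     (40, -1), (40, 5), (41, 41), (48, -1), (48, 3), (50, 5)}"
    and "X0_model N \<xi> \<eta>"
    and "\<nexists>r :: rat. f_X0 N x0 = r^2"
    and "noncuspidal_point \<xi> \<eta> (of_rat x0) (csqrt (of_rat (f_X0 N x0)))"
    and "prime p"
    and "ramifies_in p (quadratic_field (f_X0 N x0))"
    and "(N, a) = (28, -7) \<Longrightarrow> p \<noteq> 2"
  shows "QuadRes (int p) a"
proof -
  show ?thesis
    using f_X0_eq_norm[OF assms(1)] QuadRes_if_ramifies_in_norm assms(3,5,6) by blast
qed

end
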